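(* Let $S$ be a countable, discrete semigroup satisfying the strong F{\o}lner condition (SFC) and let $(F_N)_{N\ge1}$ be a right F{\o}lner sequence for $S$. Let $\mathcal{H}$ be a complex Hilbert space and let $\pi:S\to\mathcal{B}(\mathcal{H})$ be a representation of $S$ such that $$m^2I\le\frac{1}{|F_N|}\sum_{g\in F_N}\pi(g)^{*}\pi(g)\le M^2I\qquad(N\ge1)$$ for some positive constants $m$ and $M$, and $$\lim_{N\to\infty}\frac{1}{|F_N|}\sum_{g\in F_Ns\,\triangle\,F_N}\|\pi(g)\|^2=0$$ for every $s\in S$. Then there exists an invertible operator $L\in\mathcal{B}(\mathcal{H})$ with $\|L^{-1}\|\,\|L\|\le Mm^{-1}$ such that $L^{-1}\pi(\cdot)L$ is an isometric representation.
   Context: $|E|$ denotes the cardinality of a finite set $E\subset S$; $Fs=\{fs:f\in F\}$ for $F\subset S$, $s\in S$; $A\triangle B=(A\setminus B)\cup(B\setminus A)$. The semigroup $S$ satisfies the strong F{\o}lner condition (SFC) if for every finite subset $H$ of $S$ and every $\epsilon>0$ there is a finite nonempty subset $F$ of $S$ with $|F\setminus Fs|\le\epsilon|F|$ for all $s\in H$. A right F{\o}lner sequence for $S$ is a sequence of finite nonempty sets $F_N\subset S$ ($N\ge1$) such that $$\lim_{N\to\infty}\frac{|F_Ns\,\triangle\,F_N|}{|F_N|}=0\quad\text{for each } s\in S.$$ $\mathcal{B}(\mathcal{H})$ is the algebra of bounded linear operators on $\mathcal{H}$, and inequalities between self-adjoint operators are in the usual (quadratic form) order. A representation of $S$ is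 a map $\pi:S\to\mathcal{B}(\mathcal{H})$ with $\pi(st)=\pi(s)\pi(t)$ for all $s,t\in S$. It is an isometric representation if $\pi(s)^*\pi(s)=I$ for every $s\in S$. *)

theory Defs
  imports "HOL-Analysis.Analysis"
begin

section \<open>Complex Hilbert spaces\<close>

class complex_vector = real_vector +
  fixes scaleC :: "complex \<Rightarrow> 'a \<Rightarrow> 'a"  (infixr \<open>*\<^sub>C\<close> 75)
  assumes scaleC_add_right: "a *\<^sub>C (x + y) = a *\<^sub>C x + a *\<^sub>C y"
    and scaleC_add_left: "(a + b) *\<^sub>C x = a *\<^sub>C x + b *\<^sub>C x"
    and scaleC_scaleC: "a *\<^sub>C (b *\<^sub>C x) = (a * b) *\<^sub>C x"
    and scaleC_one: "1 *\<^sub>C x = x"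
    and scaleR_scaleC: "scaleR r x = complex_of_real r *\<^sub>C x"

text \<open>The inner product is linear in its first and conjugate-linear in its second argument.\<close>

class complex_inner = complex_vector + real_normed_vector +
  fixes cinner :: "'a \<Rightarrow> 'a \<Rightarrow> complex"
  assumes cinner_commute: "cinner x y = cnj (cinner y x)"
    and cinner_add_left: "cinner (x + y) z = cinner x z + cinner y z"
    and cinner_scaleC_left: "cinner (c *\<^sub>C x) y = c * cinner x y"
    and cinner_self: "cinner x x = complex_of_real ((norm x)\<^sup>2)"

class complex_hilbert_space = complex_inner + complete_space

instantiation complex :: complex_hilbert_space
begin

definition scaleC_complex :: "complex \<Rightarrow> complex \<Rightarrow> complex"
  where "scaleC_complex c z = c * z"

definition cinner_complex :: "complex \<Rightarrow> complex \<Rightarrow> complex"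
  where "cinner_complex z w = z * cnj w"

instance
  by standard
    (simp_all add: scaleC_complex_def cinner_complex_def algebra_simps scaleR_conv_of_real
      complex_mult_cnj cmod_power2)

end

section \<open>Bounded operators\<close>

text \<open>
  \<open>'h \<Rightarrow>\<^sub>L 'h\<close> consists of the bounded real-linear maps; its norm, the operator norm
  \<open>sup \<parallel>A x\<parallel> / \<parallel>x\<parallel>\<close>, refers only to the vectors of the space and so is also the norm
  of the algebra of bounded complex-linear operators.
\<close>

definition bounded_ops :: "('h::complex_hilbert_space \<Rightarrow>\<^sub>L 'h) set"
  where "bounded_ops = {A. \<forall>c x. blinfun_apply A (c *\<^sub>C x) = c *\<^sub>C blinfun_apply A x}"

definition op_adjoint ::
    "('h::complex_hilbert_space \<Rightarrow>\<^sub>L 'h) \<Rightarrow> ('h \<Rightarrow>\<^sub>L 'h)"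
  where "op_adjoint A =
    (THE B. B \<in> bounded_ops \<and>
      (\<forall>x y. cinner (blinfun_apply A x) y = cinner x (blinfun_apply B y)))"

text \<open>
  Intended for self-adjoint operators, where the inner products below are real.
\<close>

definition op_le ::
    "('h::complex_hilbert_space \<Rightarrow>\<^sub>L 'h) \<Rightarrow> ('h \<Rightarrow>\<^sub>L 'h) \<Rightarrow> bool"
  where "op_le A B \<longleftrightarrow>
    (\<forall>x. Re (cinner (blinfun_apply A x) x) \<le> Re (cinner (blinfun_apply B x) x))"

section \<open>Semigroups and their representations\<close>

definition right_translate :: "'s::semigroup_mult set \<Rightarrow> 's \<Rightarrow> 's set"
  where "right_translate F s = (\<lambda>f. f * s) ` F"

definition strong_Folner_condition :: "'s::semigroup_mult itself \<Rightarrow> bool"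
  where "strong_Folner_condition _ \<longleftrightarrow>
    (\<forall>H :: 's set. \<forall>\<epsilon> > 0. finite H \<longrightarrow>
      (\<exists>F :: 's set. finite F \<and> F \<noteq> {} \<and>
        (\<forall>s\<in>H. real (card (F - right_translate F s)) \<le> \<epsilon> * real (card F))))"

text \<open>Sequences are indexed by \<open>N \<ge> 1\<close>; the value at \<open>0\<close> is irrelevant.\<close>

definition right_Folner_sequence :: "(nat \<Rightarrow> 's::semigroup_mult set) \<Rightarrow> bool"
  where "right_Folner_sequence F \<longleftrightarrow>
    (\<forall>N\<ge>1. finite (F N) \<and> F N \<noteq> {}) \<and>
    (\<forall>s. (\<lambda>N. real (card (sym_diff (right_translate (F N) s) (F N))) / real (card (F N)))
      \<longlonglongrightarrow> 0)"

definition op_representation ::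
    "('s::semigroup_mult \<Rightarrow> ('h::complex_hilbert_space \<Rightarrow>\<^sub>L 'h)) \<Rightarrow> bool"
  where "op_representation \<pi> \<longleftrightarrow>
    (\<forall>s. \<pi> s \<in> bounded_ops) \<and> (\<forall>s t. \<pi> (s * t) = \<pi> s o\<^sub>L \<pi> t)"

definition isometric_representation ::
    "('s::semigroup_mult \<Rightarrow> ('h::complex_hilbert_space \<Rightarrow>\<^sub>L 'h)) \<Rightarrow> bool"
  where "isometric_representation \<pi> \<longleftrightarrow>
    op_representation \<pi> \<and> (\<forall>s. op_adjoint (\<pi> s) o\<^sub>L \<pi> s = id_blinfun)"

end

theory Submission
  imports Defs
begin

text \<open>
  Let \<open>W N x\<close> be the average of \<open>\<parallel>\<pi> g x\<parallel>\<^sup>2\<close> over \<open>g \<in> F N\<close>. Summing over \<open>g * s\<close> counts every point of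
  the translate at least once, so \<open>W N x \<le> W N (\<pi> s x) + o(1)\<close>, whence
  \<open>m \<parallel>x\<parallel> \<le> M \<parallel>\<pi> s x\<parallel>\<close>. Applied to \<open>\<pi> (g * s) x = \<pi> g (\<pi> s x)\<close>, this
  makes almost all terms of \<open>W N x\<close> at least \<open>(m / M)\<^sup>2 \<parallel>\<pi> s x\<parallel>\<^sup>2\<close>, so \<open>\<pi>\<close> is uniformly bounded. The
  non-injectivity of right translation then contributes only \<open>o(1)\<close>, and \<open>W N (\<pi> s x) - W N x\<close> tends to
  \<open>0\<close>. A pointwise cluster point of the associated sesquilinear forms (Tychonoff) is an invariant form \<open>q\<close>
  with \<open>m\<^sup>2 \<parallel>x\<parallel>\<^sup>2 \<le> q x x \<le> M\<^sup>2 \<parallel>x\<parallel>\<^sup>2\<close>, and \<open>L\<close> is the inverse of the positive square root of the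
  operator representing \<open>q / M\<^sup>2\<close>.
\<close>

section \<open>Real inner products and the Riesz representation\<close>

instance complex_hilbert_space \<subseteq> banach ..

text \<open>Bounded operators here are real-linear maps, so the analysis runs on the real inner
  product; complex linearity travels separately, as the identity
  \<open>b x (c *\<^sub>C y) = b (cnj c *\<^sub>C x) y\<close> for real forms
  \<open>b\<close>.\<close>

definition rinner :: "'a::complex_inner \<Rightarrow> 'a \<Rightarrow> real"
  where "rinner x y = Re (cinner x y)"

lemma rinner_commute: "rinner x y = rinner y x"
  unfolding rinner_def by (subst cinner_commute) simp

lemma rinner_self: "rinner x x = (norm x)\<^sup>2"
  by (simp add: rinner_def cinner_self)

lemma rinner_add_left: "rinner (x + y) z = rinner x z + rinner y z"
  by (simp add: rinner_def cinner_add_left)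

lemma rinner_scaleR_left: "rinner (r *\<^sub>R x) y = r * rinner x y"
  by (simp add: rinner_def scaleR_scaleC cinner_scaleC_left)

lemma bilinear_rinner: "bilinear rinner"
  unfolding bilinear_def
proof (intro conjI allI)
  show "linear (\<lambda>y. rinner x y)" for x :: 'a
    by (rule linearI) (simp_all add: rinner_commute[of x] rinner_add_left rinner_scaleR_left)
  show "linear (\<lambda>x. rinner x y)" for y :: 'a
    by (rule linearI) (simp_all add: rinner_add_left rinner_scaleR_left)
qed

lemma scaleC_cinner_right: "cinner x (c *\<^sub>C y) = cnj c * cinner x y"
  by (metis cinner_commute cinner_scaleC_left complex_cnj_mult)

lemma rinner_scaleC: "rinner (c *\<^sub>C x) y = rinner x (cnj c *\<^sub>C y)"
  by (simp add: rinner_def cinner_scaleC_left scaleC_cinner_right)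

text \<open>The imaginary part is recovered from
  \<open>cinner x (\<i> *\<^sub>C y) = - \<i> * cinner x y\<close>; hence real identities between
  complex-linear maps lift to complex ones.\<close>

lemma cinner_eq_rinner: "cinner x y = Complex (rinner x y) (rinner x (\<i> *\<^sub>C y))"
  by (simp add: rinner_def scaleC_cinner_right complex_eq_iff)

lemma parallelogram:
  fixes x y :: "'a::complex_inner"
  shows "(norm (x + y))\<^sup>2 + (norm (x - y))\<^sup>2 = 2 * (norm x)\<^sup>2 + 2 * (norm y)\<^sup>2"
  by (simp add: bilinear_ladd[OF bilinear_rinner] bilinear_radd[OF bilinear_rinner]
      bilinear_lsub[OF bilinear_rinner] bilinear_rsub[OF bilinear_rinner] flip: rinner_self)

text \<open>Polarization and the parallelogram law bound \<open>b u v\<close> by \<open>t\<close> at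
  unit vectors. Normalizing first is what yields a product of norms rather than a sum of
  squares.\<close>

lemma symmetric_form_bound:
  fixes b :: "'a::complex_inner \<Rightarrow> 'a \<Rightarrow> real"
  assumes b: "bilinear b" and sym: "\<And>x y. b x y = b y x"
    and diag: "\<And>x. \<bar>b x x\<bar> \<le> t * (norm x)\<^sup>2"
  shows "\<bar>b x y\<bar> \<le> t * norm x * norm y"
proof (cases "x = 0 \<or> y = 0")
  case True
  then show ?thesis
    using bilinear_lzero[OF b] bilinear_rzero[OF b] by auto
next
  case False
  define u where "u = (1 / norm x) *\<^sub>R x"
  define v where "v = (1 / norm y) *\<^sub>R y"
  have uv: "norm u = 1" "norm v = 1"
    using False by (auto simp: u_def v_def)
  have "4 * b u v = b (u + v) (u + v) - b (u - v) (u - v)"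
    by (simp add: bilinear_ladd[OF b] bilinear_radd[OF b] bilinear_lsub[OF b] bilinear_rsub[OF b]
        sym[of v u])
  then have "\<bar>4 * b u v\<bar> \<le> t * ((norm (u + v))\<^sup>2 + (norm (u - v))\<^sup>2)"
    using diag[of "u + v"] diag[of "u - v"] by (simp add: algebra_simps)
  then have *: "\<bar>b u v\<bar> \<le> t"
    using uv by (simp add: parallelogram)
  have "b x y = norm x * norm y * b u v"
    using False by (simp add: u_def v_def bilinear_lmul[OF b] bilinear_rmul[OF b])
  then have "\<bar>b x y\<bar> = norm x * norm y * \<bar>b u v\<bar>"
    by (simp add: abs_mult)
  also have "\<dots> \<le> norm x * norm y * t"
    by (intro mult_left_mono *) auto
  finally show ?thesis
    by (simp add: mult_ac)
qed

lemma rinner_Cauchy_Schwarz: "\<bar>rinner x y\<bar> \<le> norm x * norm y"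
  using symmetric_form_bound[OF bilinear_rinner rinner_commute, of 1] by (simp add: rinner_self)

lemma bounded_bilinear_if_bilinear:
  assumes b: "bilinear b" and bound: "\<And>x y. norm (b x y) \<le> K * norm x * norm y"
  shows "bounded_bilinear b"
proof
  show "\<exists>K. \<forall>x y. norm (b x y) \<le> norm x * norm y * K"
    using bound by (auto intro!: exI[of _ K] simp: mult_ac)
qed (simp_all add: bilinear_ladd[OF b] bilinear_radd[OF b] bilinear_lmul[OF b] bilinear_rmul[OF b])

lemma bounded_bilinear_rinner: "bounded_bilinear rinner"
  by (rule bounded_bilinear_if_bilinear[OF bilinear_rinner, of 1])
    (simp add: rinner_Cauchy_Schwarz)

lemma rinner_eqI:
  assumes "\<And>z. rinner z x = rinner z y"
  shows "x = y"
proof -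
  have "rinner (x - y) (x - y) = 0"
    using assms by (simp add: bilinear_rsub[OF bilinear_rinner])
  then show ?thesis
    by (simp add: rinner_self)
qed

text \<open>Variational proof: if \<open>u\<close> represents \<open>f\<close>, then
  \<open>J x\<close> equals \<open>(norm (x - u))\<^sup>2 - (norm u)\<^sup>2\<close>, so
  \<open>u\<close> has to be the minimizer of \<open>J\<close>.\<close>

lemma riesz_representation:
  fixes f :: "'a::complex_hilbert_space \<Rightarrow> real"
  assumes f: "bounded_linear f"
  shows "\<exists>u. \<forall>x. f x = rinner x u"
proof -
  interpret f: bounded_linear f by fact
  define J where "J x = (norm x)\<^sup>2 - 2 * f x" for x
  obtain K where K: "\<And>x. norm (f x) \<le> norm x * K"
    using f.bounded by blast
  have J_ge: "- K\<^sup>2 \<le> J x" for x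
  proof -
    have "2 * f x \<le> 2 * norm x * K"
      using K[of x] by simp
    moreover have "0 \<le> (norm x - K)\<^sup>2"
      by simp
    ultimately show ?thesis
      by (simp add: J_def power2_diff)
  qed
  then have bdd: "bdd_below (range J)"
    by (auto intro!: bdd_belowI)
  define I where "I = Inf (range J)"
  have I_le: "I \<le> J x" for x
    unfolding I_def by (rule cInf_lower[OF _ bdd]) simp
  have "\<exists>x. J x < I + 1 / real (Suc n)" for n
    using cInf_less_iff[of "range J" "I + 1 / real (Suc n)"] bdd by (auto simp: I_def)
  then obtain X where X: "\<And>n. J (X n) < I + 1 / real (Suc n)"
    by metis
  \<comment> \<open>Comparing \<open>J\<close> at the midpoint of \<open>x\<close> and
    \<open>y\<close> with its infimum makes every minimizing sequence Cauchy.\<close>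
  have close: "(norm (x - y))\<^sup>2 \<le> 2 * (J x - I) + 2 * (J y - I)" for x y
  proof -
    have "4 * J ((1/2) *\<^sub>R (x + y)) = (norm (x + y))\<^sup>2 - 4 * f x - 4 * f y"
      by (simp add: J_def f.scaleR f.add power_divide) (simp add: field_simps)
    then have "(norm (x + y))\<^sup>2 \<ge> 4 * I + 4 * f x + 4 * f y"
      using I_le[of "(1/2) *\<^sub>R (x + y)"] by simp
    then show ?thesis
      using parallelogram[of x y] by (simp add: J_def)
  qed
  have "Cauchy X"
  proof (rule metric_CauchyI)
    fix e :: real assume e: "0 < e"
    define d where "d = e\<^sup>2 / 4"
    have d: "0 < d" "e\<^sup>2 = 4 * d"
      using e by (simp_all add: d_def)
    obtain n where n: "1 / real (Suc n) < d"
      using d(1) nat_approx_posE by metis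
    have small: "J (X k) - I < d" if "k \<ge> n" for k
    proof -
      have "1 / real (Suc k) \<le> 1 / real (Suc n)"
        using that by (simp add: frac_le)
      then show ?thesis
        using X[of k] n by linarith
    qed
    have "dist (X k) (X l) < e" if "k \<ge> n" "l \<ge> n" for k l
    proof -
      have "2 * (J (X k) - I) + 2 * (J (X l) - I) < 4 * d"
        using small[OF that(1)] small[OF that(2)] by simp
      then have "(norm (X k - X l))\<^sup>2 < e\<^sup>2"
        unfolding d(2) by (rule order.strict_trans1[OF close])
      then show ?thesis
        using e by (simp add: dist_norm power_less_imp_less_base)
    qed
    then show "\<exists>n. \<forall>k\<ge>n. \<forall>l\<ge>n. dist (X k) (X l) < e"
      by blast
  qed
  then obtain u where u: "X \<longlonglongrightarrow> u"
    using Cauchy_convergent_iff convergent_def by blast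
  have "(\<lambda>n. J (X n)) \<longlonglongrightarrow> J u"
    unfolding J_def by (intro tendsto_intros u f.tendsto)
  moreover have "(\<lambda>n. I + 1 / real (Suc n)) \<longlonglongrightarrow> I + 0"
    by (intro tendsto_add tendsto_const LIMSEQ_Suc lim_1_over_n)
  ultimately have "J u \<le> I + 0"
    by (rule LIMSEQ_le) (use X in \<open>auto intro: less_imp_le\<close>)
  then have min: "J u \<le> J y" for y
    using I_le[of y] by simp
  have "f x = rinner x u" for x
  proof -
    define c where "c = rinner x u - f x"
    define n where "n = (norm x)\<^sup>2"
    have n: "n \<ge> 0"
      by (simp add: n_def)
    \<comment> \<open>For \<open>x\<close> nonzero the quadratic
      \<open>t\<^sup>2 * n + 2 * t * c\<close> is smallest at \<open>- c / n\<close>; the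
      denominator \<open>n + 1\<close> also covers \<open>x = 0\<close> and still gives a negative
      value unless \<open>c = 0\<close>.\<close>
    define t where "t = - c / (n + 1)"
    have "(norm (u + t *\<^sub>R x))\<^sup>2 = (norm u)\<^sup>2 + 2 * t * rinner x u + t\<^sup>2 * (norm x)\<^sup>2"
      unfolding rinner_self[symmetric]
      by (simp add: rinner_commute[of u x] power2_eq_square algebra_simps
          bilinear_ladd[OF bilinear_rinner] bilinear_radd[OF bilinear_rinner]
          bilinear_lmul[OF bilinear_rinner] bilinear_rmul[OF bilinear_rinner])
    then have "J (u + t *\<^sub>R x) = J u + t\<^sup>2 * n + 2 * t * c"
      by (simp add: J_def n_def c_def f.add f.scaleR algebra_simps)
    then have "0 \<le> t\<^sup>2 * n + 2 * t * c"
      using min[of "u + t *\<^sub>R x"] by simp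
    also have "\<dots> = - (c\<^sup>2 * (n + 2)) / (n + 1)\<^sup>2"
      using n unfolding t_def by (simp add: divide_simps power2_eq_square) algebra
    finally have "c\<^sup>2 * (n + 2) \<le> 0"
      using n by (auto simp: divide_le_0_iff)
    then have "c\<^sup>2 \<le> 0"
      using n by (simp add: mult_le_0_iff)
    then show ?thesis
      by (simp add: c_def)
  qed
  then show ?thesis
    by blast
qed

section \<open>Operators represented by forms, and adjoints\<close>

lemma bounded_bilinear_form_operator:
  fixes b :: "'a::complex_hilbert_space \<Rightarrow> 'a \<Rightarrow> real"
  assumes b: "bounded_bilinear b"
  obtains P :: "'a \<Rightarrow>\<^sub>L 'a" where "\<And>x y. b x y = rinner x (P y)"
proof -
  interpret b: bounded_bilinear b by fact
  obtain K where K: "0 \<le> K" "\<And>x y. norm (b x y) \<le> norm x * norm y * K"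
    using b.nonneg_bounded by blast
  have "\<exists>u. \<forall>x. b x y = rinner x u" for y
    by (rule riesz_representation) (rule b.bounded_linear_left)
  then obtain p where p: "\<And>x y. b x y = rinner x (p y)"
    by metis
  have "bounded_linear p"
  proof (rule bounded_linear_intro)
    show "p (y + z) = p y + p z" for y z
      by (rule rinner_eqI) (simp add: b.add_right bilinear_radd[OF bilinear_rinner] flip: p)
    show "p (r *\<^sub>R y) = r *\<^sub>R p y" for r y
      by (rule rinner_eqI) (simp add: b.scaleR_right bilinear_rmul[OF bilinear_rinner] flip: p)
    \<comment> \<open>The bound comes from testing the form at \<open>p y\<close> itself and
      cancelling one factor.\<close>
    show "norm (p y) \<le> norm y * K" for y
    proof (cases "p y = 0")
      case False
      have "norm (p y) * norm (p y) = b (p y) y"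
        by (simp add: p rinner_self power2_eq_square)
      also have "\<dots> \<le> norm (p y) * (norm y * K)"
        using K(2)[of "p y" y] by (simp add: mult_ac)
      finally show ?thesis
        using False by simp
    qed (use K in simp)
  qed
  then have "b x y = rinner x (Blinfun p y)" for x y
    by (simp add: bounded_linear_Blinfun_apply p)
  then show thesis
    using that by blast
qed

lemma bounded_ops_if_form:
  fixes P :: "'a::complex_hilbert_space \<Rightarrow>\<^sub>L 'a"
  assumes form: "\<And>x y. b x y = rinner x (P y)"
    and scaleC: "\<And>c x y. b x (c *\<^sub>C y) = b (cnj c *\<^sub>C x) y"
  shows "P \<in> bounded_ops"
proof -
  have "P (c *\<^sub>C y) = c *\<^sub>C P y" for c y
  proof (rule rinner_eqI)
    show "rinner z (P (c *\<^sub>C y)) = rinner z (c *\<^sub>C P y)" for z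
      using scaleC[of z c y] by (simp add: form rinner_scaleC)
  qed
  then show ?thesis
    by (simp add: bounded_ops_def)
qed

text \<open>\<open>op_adjoint\<close> is a definite description, so it can be used only after
  existence (from the Riesz representation) and uniqueness (vectors are separated by
  \<open>rinner\<close>) are established.\<close>

lemma rinner_op_adjoint:
  assumes A: "A \<in> bounded_ops"
  shows "rinner (blinfun_apply A x) y = rinner x (op_adjoint A y)"
proof -
  interpret A: bounded_bilinear "\<lambda>x y. rinner (blinfun_apply A x) y"
    by (rule bounded_bilinear.comp1[OF bounded_bilinear_rinner blinfun.bounded_linear_right])
  obtain B where B: "\<And>x y. rinner (A x) y = rinner x (blinfun_apply B y)"
    using bounded_bilinear_form_operator[OF A.bounded_bilinear_axioms] by metis
  have B_ops: "B \<in> bounded_ops"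
    by (rule bounded_ops_if_form[OF B])
      (use A in \<open>simp add: bounded_ops_def rinner_scaleC\<close>)
  have "op_adjoint A = B"
    unfolding op_adjoint_def
  proof (rule the_equality)
    show "B \<in> bounded_ops \<and> (\<forall>x y. cinner (A x) y = cinner x (B y))"
      using B_ops by (simp add: cinner_eq_rinner bounded_ops_def B)
  next
    fix C assume C: "C \<in> bounded_ops \<and> (\<forall>x y. cinner (A x) y = cinner x (blinfun_apply C y))"
    show "C = B"
    proof (rule blinfun_eqI, rule rinner_eqI)
      show "rinner z (C i) = rinner z (B i)" for z i
        using C B[of z i] by (simp add: rinner_def)
    qed
  qed
  then show ?thesis
    by (simp add: B)
qed

text \<open>By polarization a norm-preserving linear map preserves \<open>rinner\<close>, and moving
  one factor across by the adjoint identifies the composite.\<close>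

lemma op_adjoint_compose_eq_id:
  assumes A: "A \<in> bounded_ops" and iso: "\<And>x. norm (blinfun_apply A x) = norm x"
  shows "op_adjoint A o\<^sub>L A = id_blinfun"
proof (rule blinfun_eqI, rule rinner_eqI)
  fix x z
  have polar: "4 * rinner x y = (norm (x + y))\<^sup>2 - (norm (x - y))\<^sup>2" for x y :: 'a
    by (simp add: bilinear_ladd[OF bilinear_rinner] bilinear_radd[OF bilinear_rinner]
        bilinear_lsub[OF bilinear_rinner] bilinear_rsub[OF bilinear_rinner]
        rinner_commute[of y x] flip: rinner_self)
  have "4 * rinner (A z) (A x) = 4 * rinner z x"
    by (simp add: polar iso flip: blinfun.add_right blinfun.diff_right)
  then show "rinner z ((op_adjoint A o\<^sub>L A) x) = rinner z (id_blinfun x)"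
    by (simp add: rinner_op_adjoint[OF A, symmetric])
qed

section \<open>Square roots and similarities\<close>

text \<open>The bound on \<open>norm T\<close>, used later with \<open>t < 1\<close>, makes the
  fixed-point construction of a square root contract.\<close>

lemma operator_of_small_form:
  fixes c :: "'a::complex_hilbert_space \<Rightarrow> 'a \<Rightarrow> real"
  assumes c: "bilinear c" and sym: "\<And>x y. c x y = c y x"
    and diag: "\<And>x. \<bar>c x x\<bar> \<le> t * (norm x)\<^sup>2" and t: "0 \<le> t"
  obtains T :: "'a \<Rightarrow>\<^sub>L 'a" where "norm T \<le> t" "\<And>x y. c x y = rinner x (T y)"
proof -
  have bound: "\<bar>c x y\<bar> \<le> t * norm x * norm y" for x y
    by (rule symmetric_form_bound[OF c sym diag])
  then have "bounded_bilinear c"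
    by (intro bounded_bilinear_if_bilinear[OF c, of t]) simp
  then obtain T :: "'a \<Rightarrow>\<^sub>L 'a" where T: "\<And>x y. c x y = rinner x (T y)"
    using bounded_bilinear_form_operator by blast
  have "norm (T y) \<le> t * norm y" for y
  proof (cases "T y = 0")
    case False
    have "norm (T y) * norm (T y) = c (T y) y"
      by (simp add: T rinner_self power2_eq_square)
    also have "\<dots> \<le> norm (T y) * (t * norm y)"
      using bound[of "T y" y] by (simp add: mult_ac)
    finally show ?thesis
      using False by simp
  qed (use t in simp)
  then have "norm T \<le> t"
    by (intro norm_blinfun_bound t)
  then show thesis
    using T that by blast
qed

text \<open>\<open>1 - Y\<close> squares to \<open>1 - T\<close> exactly when \<open>Y\<close> is a fixed point of \<open>Y \<mapsto> (T + Y\<^sup>2) / 2\<close>, which is a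
  contraction of the ball of radius \<open>t\<close>.\<close>

lemma sqrt_one_minus_operator:
  fixes T :: "'a::complex_hilbert_space \<Rightarrow>\<^sub>L 'a"
  assumes norm_T: "norm T \<le> t" and t: "0 \<le> t" "t < 1"
    and T_sym: "\<And>x y. rinner x (T y) = rinner (T x) y"
    and T_scaleC: "\<And>c x y. rinner x (T (c *\<^sub>C y)) = rinner (cnj c *\<^sub>C x) (T y)"
  obtains Y where "norm Y \<le> t" "Y \<in> bounded_ops" "\<And>x y. rinner x (blinfun_apply Y y) = rinner (blinfun_apply Y x) y"
    "\<And>x. 2 *\<^sub>R blinfun_apply Y x = T x + blinfun_apply Y (blinfun_apply Y x)"
proof -
  \<comment> \<open>All conditions are equations or inequalities continuous in \<open>Y\<close>, so
    \<open>S\<close> is closed and the fixed point found in it is automatically self-adjoint and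
    complex-linear.\<close>
  define S where "S = {Y :: 'a \<Rightarrow>\<^sub>L 'a. norm Y \<le> t \<and>
    (\<forall>x y. rinner x (blinfun_apply Y y) = rinner (blinfun_apply Y x) y) \<and>
    (\<forall>c x y. rinner x (blinfun_apply Y (c *\<^sub>C y)) = rinner (cnj c *\<^sub>C x) (blinfun_apply Y y))}"
  define \<Phi> where "\<Phi> Y = (1/2) *\<^sub>R (T + (Y o\<^sub>L Y))" for Y :: "'a \<Rightarrow>\<^sub>L 'a"
  have S_ops: "Y \<in> bounded_ops" if "Y \<in> S" for Y
    by (rule bounded_ops_if_form[OF refl]) (use that in \<open>unfold S_def, blast\<close>)
  have cont: "continuous_on UNIV (\<lambda>Y :: 'a \<Rightarrow>\<^sub>L 'a. rinner x (blinfun_apply Y y))"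
    "continuous_on UNIV (\<lambda>Y :: 'a \<Rightarrow>\<^sub>L 'a. rinner (blinfun_apply Y x) y)" for x y
    by (intro bounded_bilinear.continuous_on[OF bounded_bilinear_rinner]
        blinfun.continuous_on continuous_on_id continuous_on_const)+
  have "closed S"
    unfolding S_def
    by (intro closed_Collect_conj closed_Collect_all closed_Collect_eq closed_Collect_le cont
        continuous_on_norm continuous_on_id continuous_on_const)
  then have "complete S"
    by (simp add: complete_eq_closed)
  moreover have "0 \<in> S"
    using t by (simp add: S_def bilinear_lzero[OF bilinear_rinner] bilinear_rzero[OF bilinear_rinner])
  moreover have "\<Phi> Y \<in> S" if Y: "Y \<in> S" for Y
  proof -
    have "norm (Y o\<^sub>L Y) \<le> norm Y * norm Y"
      by (rule norm_blinfun_compose)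
    also have "\<dots> \<le> t * 1"
      using Y t by (intro mult_mono) (auto simp: S_def)
    finally have "norm (\<Phi> Y) \<le> t"
      using norm_T norm_triangle_ineq[of T "Y o\<^sub>L Y"] by (simp add: \<Phi>_def)
    moreover have "rinner x (Y (Y y)) = rinner (Y (Y x)) y" for x y
      using Y by (simp add: S_def)
    moreover have "rinner x (Y (Y (c *\<^sub>C y))) = rinner (cnj c *\<^sub>C x) (Y (Y y))" for c x y
    proof -
      have "Y (c *\<^sub>C y) = c *\<^sub>C Y y" for y
        using S_ops[OF Y] by (simp add: bounded_ops_def)
      then show ?thesis
        by (simp add: rinner_scaleC)
    qed
    moreover have "rinner (T x) (c *\<^sub>C y) = rinner (T (cnj c *\<^sub>C x)) y" for c x y
      by (simp add: T_scaleC flip: T_sym)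
    ultimately show ?thesis
      by (simp add: S_def \<Phi>_def blinfun.add_left blinfun.scaleR_left T_sym
          bilinear_ladd[OF bilinear_rinner] bilinear_radd[OF bilinear_rinner]
          bilinear_lmul[OF bilinear_rinner] bilinear_rmul[OF bilinear_rinner])
  qed
  moreover have "dist (\<Phi> Y) (\<Phi> Z) \<le> t * dist Y Z" if "Y \<in> S" "Z \<in> S" for Y Z
  proof -
    \<comment> \<open>The difference of squares is split as \<open>Y (Y - Z) + (Y - Z) Z\<close>,
      since \<open>Y\<close> and \<open>Z\<close> need not commute.\<close>
    have "\<Phi> Y - \<Phi> Z = (1/2) *\<^sub>R ((Y o\<^sub>L (Y - Z)) + ((Y - Z) o\<^sub>L Z))"
      by (rule blinfun_eqI) (simp add: \<Phi>_def blinfun.add_left blinfun.diff_left blinfun.diff_right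
          blinfun.scaleR_left algebra_simps)
    then have "2 * norm (\<Phi> Y - \<Phi> Z) = norm ((Y o\<^sub>L (Y - Z)) + ((Y - Z) o\<^sub>L Z))"
      by simp
    also have "\<dots> \<le> norm Y * norm (Y - Z) + norm (Y - Z) * norm Z"
      by (intro norm_triangle_le add_mono norm_blinfun_compose)
    also have "\<dots> \<le> t * norm (Y - Z) + norm (Y - Z) * t"
      using that by (intro add_mono mult_left_mono mult_right_mono) (auto simp: S_def)
    finally show ?thesis
      by (simp add: dist_norm)
  qed
  ultimately obtain Y where Y: "Y \<in> S" "\<Phi> Y = Y"
    using Banach_fix[of S t \<Phi>] t by blast
  have "2 *\<^sub>R Y x = T x + Y (Y x)" for x
  proof -
    have "2 *\<^sub>R Y x = 2 *\<^sub>R \<Phi> Y x"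
      by (simp add: Y)
    then show ?thesis
      by (simp add: \<Phi>_def blinfun.add_left blinfun.scaleR_left)
  qed
  then show thesis
    using Y S_ops by (intro that) (auto simp: S_def)
qed

text \<open>Dividing by \<open>M\<^sup>2\<close> turns \<open>b\<close> into the form of
  \<open>1 - T\<close> with \<open>norm T < 1\<close>. If \<open>R\<close> is the square root of
  \<open>1 - T\<close>, then \<open>L' = R\<close> and \<open>L\<close> is its inverse:
  \<open>upper\<close> gives \<open>norm R \<le> 1\<close> and \<open>lower\<close> gives
  \<open>norm L \<le> M / m\<close>.\<close>

lemma similarity_of_form:
  fixes b :: "'a::complex_hilbert_space \<Rightarrow> 'a \<Rightarrow> real"
  assumes b: "bilinear b" and sym: "\<And>x y. b x y = b y x"
    and scaleC: "\<And>c x y. b x (c *\<^sub>C y) = b (cnj c *\<^sub>C x) y"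
    and m: "0 < m" and M: "0 < M"
    and lower: "\<And>x. m\<^sup>2 * (norm x)\<^sup>2 \<le> b x x" and upper: "\<And>x. b x x \<le> M\<^sup>2 * (norm x)\<^sup>2"
  obtains L L' :: "'a \<Rightarrow>\<^sub>L 'a"
  where "L \<in> bounded_ops" "L' \<in> bounded_ops" "L o\<^sub>L L' = id_blinfun" "L' o\<^sub>L L = id_blinfun"
    "norm L' * norm L \<le> M / m" "\<And>x. b x x = M\<^sup>2 * (norm (blinfun_apply L' x))\<^sup>2"
proof -
  define c where "c x y = rinner x y - b x y / M\<^sup>2" for x y
  \<comment> \<open>The bounds force \<open>m \<le> M\<close> only on a nonzero space; the maximum
    keeps \<open>t\<close> nonnegative on the zero space too.\<close>
  define t where "t = max 0 (1 - m\<^sup>2 / M\<^sup>2)"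
  have t: "0 \<le> t" "t < 1"
    using m M by (auto simp: t_def)
  have "bilinear c"
    unfolding bilinear_def c_def
    by (intro conjI allI linearI)
      (simp_all add: bilinear_ladd[OF b] bilinear_radd[OF b] bilinear_lmul[OF b] bilinear_rmul[OF b]
        bilinear_ladd[OF bilinear_rinner] bilinear_radd[OF bilinear_rinner]
        bilinear_lmul[OF bilinear_rinner] bilinear_rmul[OF bilinear_rinner] add_divide_distrib right_diff_distrib)
  moreover have c_sym: "c x y = c y x" for x y
    by (simp add: c_def sym[of x y] rinner_commute[of x y])
  moreover have "\<bar>c x x\<bar> \<le> t * (norm x)\<^sup>2" for x
  proof -
    have "b x x / M\<^sup>2 \<le> (norm x)\<^sup>2"
      using upper[of x] M by (simp add: divide_le_eq mult.commute)
    moreover have "m\<^sup>2 * (norm x)\<^sup>2 / M\<^sup>2 \<le> b x x / M\<^sup>2"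
      using lower[of x] M by (intro divide_right_mono) auto
    moreover have "(1 - m\<^sup>2 / M\<^sup>2) * (norm x)\<^sup>2 \<le> t * (norm x)\<^sup>2"
      by (intro mult_right_mono) (auto simp: t_def)
    ultimately show ?thesis
      by (simp add: c_def rinner_self abs_le_iff algebra_simps)
  qed
  ultimately obtain T :: "'a \<Rightarrow>\<^sub>L 'a" where T: "norm T \<le> t" "\<And>x y. c x y = rinner x (T y)"
    using operator_of_small_form[of c t] t by metis
  have "rinner x (T y) = rinner (T x) y" for x y
    by (metis T(2) c_sym rinner_commute)
  moreover have "rinner x (T (d *\<^sub>C y)) = rinner (cnj d *\<^sub>C x) (T y)" for d x y
    by (simp add: c_def scaleC rinner_scaleC flip: T(2))
  ultimately obtain Y where Y: "norm Y \<le> t" "Y \<in> bounded_ops"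
    "\<And>x y. rinner x (blinfun_apply Y y) = rinner (blinfun_apply Y x) y"
    "\<And>x. 2 *\<^sub>R blinfun_apply Y x = T x + blinfun_apply Y (blinfun_apply Y x)"
    using sqrt_one_minus_operator[OF T(1) t] by metis
  define R where "R = id_blinfun - Y"
  have R: "R x = x - Y x" for x
    by (simp add: R_def blinfun.diff_left)
  have R_norm: "b x x = M\<^sup>2 * (norm (R x))\<^sup>2" for x
  proof -
    have "(norm (R x))\<^sup>2 = rinner x x - 2 * rinner x (Y x) + rinner x (Y (Y x))"
      using Y(3)[of x "Y x"] unfolding rinner_self[symmetric]
      by (simp add: R bilinear_lsub[OF bilinear_rinner] bilinear_rsub[OF bilinear_rinner]
          rinner_commute[of "Y x" x])
    \<comment> \<open>The fixed-point equation cancels the term quadratic in \<open>Y\<close>,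
      leaving \<open>rinner x x - c x x\<close>, which is \<open>b x x / M\<^sup>2\<close>.\<close>
    also have "2 * rinner x (Y x) = rinner x (2 *\<^sub>R Y x)"
      by (simp add: bilinear_rmul[OF bilinear_rinner])
    also have "\<dots> = c x x + rinner x (Y (Y x))"
      by (simp add: Y(4) T(2) bilinear_radd[OF bilinear_rinner])
    finally show ?thesis
      using M by (simp add: c_def)
  qed
  have R_ops: "R \<in> bounded_ops"
  proof (rule bounded_ops_if_form)
    show "rinner x y - rinner x (Y y) = rinner x (R y)" for x y
      by (simp add: R bilinear_rsub[OF bilinear_rinner])
    show "rinner x (d *\<^sub>C y) - rinner x (Y (d *\<^sub>C y)) = rinner (cnj d *\<^sub>C x) y - rinner (cnj d *\<^sub>C x) (Y y)"
      for d x y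
      using Y(2) by (simp add: bounded_ops_def rinner_scaleC)
  qed
  \<comment> \<open>\<open>R x = y\<close> says that \<open>x\<close> is a fixed point of the
    contraction \<open>x \<mapsto> y + Y x\<close>.\<close>
  have "\<exists>!x. R x = y" for y
  proof -
    have "dist (y + Y x) (y + Y x') \<le> t * dist x x'" for x x'
    proof -
      have "norm (Y (x - x')) \<le> norm Y * norm (x - x')"
        by (rule norm_blinfun)
      also have "\<dots> \<le> t * norm (x - x')"
        by (intro mult_right_mono Y(1)) simp
      finally show ?thesis
        by (simp add: dist_norm blinfun.diff_right)
    qed
    then have "\<exists>!x. y + Y x = x"
      using banach_fix_type[OF t, of "\<lambda>x. y + Y x"] by blast
    moreover have "R x = y \<longleftrightarrow> y + Y x = x" for x
      by (auto simp: R algebra_simps)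
    ultimately show ?thesis
      by simp
  qed
  then obtain p where p: "\<And>y. R (p y) = y" and p_R: "\<And>x. p (R x) = x"
    by metis
  have R_lower: "norm x \<le> norm (R x) * (M / m)" for x
  proof -
    have "(m * norm x)\<^sup>2 \<le> (M * norm (R x))\<^sup>2"
      using lower[of x] R_norm[of x] by (simp add: power_mult_distrib)
    then have "m * norm x \<le> M * norm (R x)"
      by (rule power2_le_imp_le) (use M in simp)
    then show ?thesis
      using m by (simp add: field_simps)
  qed
  have p_lin: "bounded_linear p"
  proof (rule bounded_linear_intro)
    show "p (x + y) = p x + p y" for x y
      by (metis blinfun.add_right p p_R)
    show "p (r *\<^sub>R x) = r *\<^sub>R p x" for r x
      by (metis blinfun.scaleR_right p p_R)
    show "norm (p x) \<le> norm x * (M / m)" for x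
      using R_lower[of "p x"] by (simp add: p)
  qed
  define L where "L = Blinfun p"
  have L: "L x = p x" for x
    by (simp add: L_def bounded_linear_Blinfun_apply p_lin)
  show thesis
  proof
    have "p (d *\<^sub>C x) = d *\<^sub>C p x" for d x
    proof -
      have "R (d *\<^sub>C p x) = d *\<^sub>C x"
        using R_ops by (simp add: bounded_ops_def p)
      then show ?thesis
        by (metis p_R)
    qed
    then show "L \<in> bounded_ops"
      by (simp add: bounded_ops_def L)
    show "R \<in> bounded_ops" by fact
    show "L o\<^sub>L R = id_blinfun" "R o\<^sub>L L = id_blinfun"
      by (auto intro!: blinfun_eqI simp: L p p_R)
    have "norm R \<le> 1"
    proof (rule norm_blinfun_bound)
      fix x
      have "(norm (R x))\<^sup>2 \<le> (norm x)\<^sup>2"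
        using upper[of x] M by (simp add: R_norm)
      then show "norm (R x) \<le> 1 * norm x"
        using power2_le_imp_le by force
    qed simp
    moreover have "norm L \<le> M / m"
    proof (rule norm_blinfun_bound)
      show "norm (L x) \<le> M / m * norm x" for x
        using R_lower[of "p x"] by (simp add: p L mult.commute)
    qed (use m M in simp)
    ultimately show "norm R * norm L \<le> M / m"
      using mult_mono[of "norm R" 1 "norm L" "M / m"] by simp
    show "b x x = M\<^sup>2 * (norm (R x))\<^sup>2" for x by fact
  qed
qed

section \<open>Averages over a Folner sequence\<close>

text \<open>By Tychonoff the functions \<open>b N\<close> lie in a compact product of intervals. A
  filter replaces a subsequence because convergence is wanted at all points \<open>z\<close> at
  once, and these may be uncountably many.\<close>

lemma pointwise_cluster_point:
  fixes b :: "nat \<Rightarrow> 'z \<Rightarrow> real"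
  assumes bound: "\<And>N z. \<bar>b N z\<bar> \<le> C z"
  obtains G q where "G \<noteq> bot" "G \<le> sequentially" "\<And>z. ((\<lambda>N. b N z) \<longlongrightarrow> q z) G"
proof -
  let ?K = "PiE UNIV (\<lambda>z. {- C z .. C z})"
  have "compactin (product_topology (\<lambda>z. euclidean) UNIV) ?K"
    unfolding compactin_PiE by simp
  then have "compact ?K"
    by (simp add: euclidean_product_topology)
  moreover have "eventually (\<lambda>f. f \<in> ?K) (filtermap b sequentially)"
    using bound by (auto simp: eventually_filtermap PiE_iff abs_le_iff minus_le_iff)
  moreover have "filtermap b sequentially \<noteq> bot"
    by (simp add: filtermap_bot_iff)
  ultimately obtain q where q: "inf (nhds q) (filtermap b sequentially) \<noteq> bot"
    unfolding compact_filter by blast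
  \<comment> \<open>Pulling the neighbourhoods of the cluster point \<open>q\<close> back to the
    indices forces convergence to \<open>q\<close>.\<close>
  define G where "G = inf (filtercomap b (nhds q)) sequentially"
  have lim: "(b \<longlongrightarrow> q) G"
    unfolding G_def filterlim_def
    by (metis filtermap_filtercomap filtermap_mono inf_le1 order_trans)
  \<comment> \<open>If \<open>G\<close> were trivial, \<open>b N\<close> would miss some
    neighbourhood of \<open>q\<close> for all large \<open>N\<close>.\<close>
  have "G \<noteq> bot"
  proof
    assume "G = bot"
    then have "eventually (\<lambda>x. False) (inf (filtercomap b (nhds q)) sequentially)"
      by (simp add: G_def)
    then obtain P Q where PQ: "eventually P (filtercomap b (nhds q))" "eventually Q sequentially"
      "\<And>x. P x \<Longrightarrow> Q x \<Longrightarrow> False"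
      unfolding eventually_inf by blast
    from PQ(1) obtain P' where P': "eventually P' (nhds q)" "\<And>x. P' (b x) \<Longrightarrow> P x"
      unfolding eventually_filtercomap by blast
    have "eventually (\<lambda>f. \<not> P' f) (filtermap b sequentially)"
      unfolding eventually_filtermap using PQ(2) by eventually_elim (use PQ P' in blast)
    then have "eventually (\<lambda>x. False) (inf (nhds q) (filtermap b sequentially))"
      unfolding eventually_inf using P'(1) by blast
    then show False
      using q by (simp add: trivial_limit_def)
  qed
  moreover have "G \<le> sequentially"
    by (simp add: G_def)
  moreover have "((\<lambda>N. b N z) \<longlongrightarrow> q z) G" for z
    using continuous_on_tendsto_compose[OF continuous_on_product_coordinates lim] by simp
  ultimately show thesis
    using that by blast
qed

text \<open>The operator inequalities are restated vector by vector, free of adjoints;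
  \<open>op_le_average_iff\<close> provides the translation.\<close>

locale Folner_bounded_representation =
  fixes F :: "nat \<Rightarrow> 's::semigroup_mult set"
    and \<pi> :: "'s \<Rightarrow> ('h::complex_hilbert_space \<Rightarrow>\<^sub>L 'h)"
    and m M :: real
  assumes m: "0 < m" and M: "0 < M"
    and finite_F: "\<And>N. N \<ge> 1 \<Longrightarrow> finite (F N)"
    and F_nonempty: "\<And>N. N \<ge> 1 \<Longrightarrow> F N \<noteq> {}"
    and card_sym_diff: "\<And>s. (\<lambda>N. real (card (sym_diff (right_translate (F N) s) (F N))) / real (card (F N)))
      \<longlonglongrightarrow> 0"
    and rep_ops: "\<And>s. \<pi> s \<in> bounded_ops"
    and rep_mult: "\<And>s t x. \<pi> (s * t) x = \<pi> s (\<pi> t x)"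
    and average_ge: "\<And>N x. N \<ge> 1 \<Longrightarrow>
      m\<^sup>2 * (norm x)\<^sup>2 \<le> (\<Sum>g\<in>F N. (norm (\<pi> g x))\<^sup>2) / real (card (F N))"
    and average_le: "\<And>N x. N \<ge> 1 \<Longrightarrow>
      (\<Sum>g\<in>F N. (norm (\<pi> g x))\<^sup>2) / real (card (F N)) \<le> M\<^sup>2 * (norm x)\<^sup>2"
    and norm_sym_diff: "\<And>s. (\<lambda>N. (\<Sum>g\<in>sym_diff (right_translate (F N) s) (F N). (norm (\<pi> g))\<^sup>2) / real (card (F N)))
      \<longlonglongrightarrow> 0"
begin

section \<open>Comparing the averages at \<open>x\<close> and at \<open>\<pi> s x\<close>\<close>

definition D :: "nat \<Rightarrow> 's \<Rightarrow> 's set"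
  where "D N s = sym_diff (right_translate (F N) s) (F N)"

definition W :: "nat \<Rightarrow> 'h \<Rightarrow> real"
  where "W N x = (\<Sum>g\<in>F N. (norm (\<pi> g x))\<^sup>2) / real (card (F N))"

lemma card_pos: "N \<ge> 1 \<Longrightarrow> 0 < real (card (F N))"
  using finite_F F_nonempty by (simp add: card_gt_0_iff)

lemma finite_translate: "N \<ge> 1 \<Longrightarrow> finite (right_translate (F N) s)"
  using finite_F by (simp add: right_translate_def)

lemma finite_D: "N \<ge> 1 \<Longrightarrow> finite (D N s)"
  using finite_F finite_translate by (simp add: D_def)

lemma sum_D_le:
  "(\<Sum>g\<in>D N s. (norm (\<pi> g x))\<^sup>2) \<le> (norm x)\<^sup>2 * (\<Sum>g\<in>D N s. (norm (\<pi> g))\<^sup>2)"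
  unfolding sum_distrib_left
proof (rule sum_mono)
  fix g
  have "(norm (\<pi> g x))\<^sup>2 \<le> (norm (\<pi> g) * norm x)\<^sup>2"
    by (intro power_mono norm_blinfun) simp
  then show "(norm (\<pi> g x))\<^sup>2 \<le> (norm x)\<^sup>2 * (norm (\<pi> g))\<^sup>2"
    by (simp add: power_mult_distrib mult.commute)
qed

lemma W_le_W_translate:
  assumes N: "N \<ge> 1"
  shows "W N x \<le> W N (\<pi> s x) + (norm x)\<^sup>2 * ((\<Sum>g\<in>D N s. (norm (\<pi> g))\<^sup>2) / real (card (F N)))"
proof -
  let ?w = "\<lambda>g. (norm (\<pi> g x))\<^sup>2"
  have "sum ?w (F N) \<le> sum ?w (right_translate (F N) s \<union> D N s)"
    using N by (intro sum_mono2) (auto simp: D_def finite_F finite_translate)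
  also have "\<dots> \<le> sum ?w (right_translate (F N) s) + sum ?w (D N s)"
    using N by (simp add: sum_Un finite_D finite_translate sum_nonneg)
  \<comment> \<open>Several \<open>g\<close> may share the same \<open>g * s\<close>; as the terms
    are nonnegative, repetition only enlarges the sum.\<close>
  also have "sum ?w (right_translate (F N) s) \<le> (\<Sum>g\<in>F N. ?w (g * s))"
    unfolding right_translate_def
    using sum_image_le[of "F N" ?w "\<lambda>f. f * s"] finite_F[OF N] by (simp add: o_def)
  also have "(\<Sum>g\<in>F N. ?w (g * s)) = (\<Sum>g\<in>F N. (norm (\<pi> g (\<pi> s x)))\<^sup>2)"
    by (simp add: rep_mult)
  finally have "sum ?w (F N) \<le> (\<Sum>g\<in>F N. (norm (\<pi> g (\<pi> s x)))\<^sup>2)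
      + (norm x)\<^sup>2 * (\<Sum>g\<in>D N s. (norm (\<pi> g))\<^sup>2)"
    using sum_D_le[where N = N and s = s and x = x] by simp
  from divide_right_mono[OF this, of "real (card (F N))"] show ?thesis
    by (simp add: W_def add_divide_distrib)
qed

text \<open>The lower average bound at \<open>x\<close> meets the upper one at
  \<open>\<pi> s x\<close>, with an error that vanishes in the limit.\<close>

lemma representation_bounded_below: "m\<^sup>2 * (norm x)\<^sup>2 \<le> M\<^sup>2 * (norm (\<pi> s x))\<^sup>2"
proof (rule LIMSEQ_le_const)
  show "(\<lambda>N. M\<^sup>2 * (norm (\<pi> s x))\<^sup>2 + (norm x)\<^sup>2 * ((\<Sum>g\<in>D N s. (norm (\<pi> g))\<^sup>2) / real (card (F N))))
    \<longlonglongrightarrow> M\<^sup>2 * (norm (\<pi> s x))\<^sup>2"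
    using tendsto_add[OF tendsto_const tendsto_mult_left[OF norm_sym_diff]]
    by (force simp: D_def)
  have "m\<^sup>2 * (norm x)\<^sup>2 \<le>
      M\<^sup>2 * (norm (\<pi> s x))\<^sup>2 + (norm x)\<^sup>2 * ((\<Sum>g\<in>D N s. (norm (\<pi> g))\<^sup>2) / real (card (F N)))"
    if "N \<ge> 1" for N
    using average_ge[OF that, of x] average_le[OF that, of "\<pi> s x"] W_le_W_translate[OF that, of x s]
    unfolding W_def by linarith
  then show "\<exists>n. \<forall>N\<ge>n. m\<^sup>2 * (norm x)\<^sup>2 \<le>
      M\<^sup>2 * (norm (\<pi> s x))\<^sup>2 + (norm x)\<^sup>2 * ((\<Sum>g\<in>D N s. (norm (\<pi> g))\<^sup>2) / real (card (F N)))"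
    by blast
qed

text \<open>This constant results from solving \<open>(m\<^sup>2 / M\<^sup>2) * (norm (\<pi> s
  x))\<^sup>2 \<le> M\<^sup>2 * (norm x)\<^sup>2\<close> for the norm on the left.\<close>

definition B :: real
  where "B = M ^ 4 / m\<^sup>2"

text \<open>For \<open>h = g * s\<close> the vector \<open>\<pi> h x = \<pi> g (\<pi> s x)\<close>
  has squared norm at least \<open>K\<close>. Such \<open>h\<close> fill all but a vanishing
  proportion of \<open>F N\<close>, while the average over \<open>F N\<close> is at most
  \<open>M\<^sup>2 * (norm x)\<^sup>2\<close>.\<close>

lemma representation_bounded: "(norm (\<pi> s x))\<^sup>2 \<le> B * (norm x)\<^sup>2"
proof -
  define K where "K = (m\<^sup>2 / M\<^sup>2) * (norm (\<pi> s x))\<^sup>2"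
  have K: "0 \<le> K"
    by (simp add: K_def)
  have translate_ge: "K \<le> (norm (\<pi> h x))\<^sup>2" if "h \<in> right_translate (F N) s" for h N
    using that representation_bounded_below[of "\<pi> s x"] M
    by (auto simp: K_def right_translate_def rep_mult field_simps)
  have "K \<le> M\<^sup>2 * (norm x)\<^sup>2"
  proof (rule LIMSEQ_le_const2)
    show "(\<lambda>N. (1 - real (card (D N s)) / real (card (F N))) * K) \<longlonglongrightarrow> K"
      using tendsto_mult_right[OF tendsto_diff[OF tendsto_const card_sym_diff[of s]], of 1 K]
      by (simp add: D_def)
    have "(1 - real (card (D N s)) / real (card (F N))) * K \<le> M\<^sup>2 * (norm x)\<^sup>2" if N: "N \<ge> 1" for N
    proof -
      have "card (F N) \<le> card ((F N \<inter> right_translate (F N) s) \<union> D N s)"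
        using N by (intro card_mono) (auto simp: D_def finite_F finite_translate)
      also have "\<dots> \<le> card (F N \<inter> right_translate (F N) s) + card (D N s)"
        by (rule card_Un_le)
      finally have "(real (card (F N)) - real (card (D N s))) * K
          \<le> real (card (F N \<inter> right_translate (F N) s)) * K"
        using K by (intro mult_right_mono) auto
      also have "\<dots> \<le> (\<Sum>g\<in>F N \<inter> right_translate (F N) s. (norm (\<pi> g x))\<^sup>2)"
        using translate_ge by (intro sum_bounded_below) auto
      also have "\<dots> \<le> (\<Sum>g\<in>F N. (norm (\<pi> g x))\<^sup>2)"
        using N by (intro sum_mono2) (auto simp: finite_F)
      finally have "(real (card (F N)) - real (card (D N s))) * K / real (card (F N)) \<le> W N x"
        unfolding W_def by (rule divide_right_mono) simp
      then have "(1 - real (card (D N s)) / real (card (F N))) * K \<le> W N x"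
        using card_pos[OF N] by (simp add: left_diff_distrib diff_divide_distrib)
      then show ?thesis
        using average_le[OF N, of x] by (simp add: W_def)
    qed
    then show "\<exists>n. \<forall>N\<ge>n. (1 - real (card (D N s)) / real (card (F N))) * K \<le> M\<^sup>2 * (norm x)\<^sup>2"
      by blast
  qed
  then show ?thesis
    using m M by (simp add: K_def B_def field_simps power4_eq_xxxx power2_eq_square)
qed

text \<open>Right translation by \<open>s\<close> need not be injective on \<open>F N\<close>; the term with \<open>B\<close> accounts for the
  collisions.\<close>

lemma W_translate_le_W:
  assumes N: "N \<ge> 1"
  shows "W N (\<pi> s x) \<le> W N x + (norm x)\<^sup>2 * ((\<Sum>g\<in>D N s. (norm (\<pi> g))\<^sup>2) / real (card (F N)))
    + B * (norm x)\<^sup>2 * (real (card (D N s)) / real (card (F N)))"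
proof -
  let ?w = "\<lambda>g. (norm (\<pi> g x))\<^sup>2" and ?B = "B * (norm x)\<^sup>2"
  let ?Fs = "right_translate (F N) s"
  have B: "0 \<le> ?B"
    by (simp add: B_def)
  \<comment> \<open>Uniform boundedness makes \<open>?B - ?w h\<close> nonnegative, so its sum over
    the image is at most the sum with repetitions. Rearranged, this bounds the repeated sum of
    \<open>?w\<close> from above, at a cost of \<open>?B\<close> per collision.\<close>
  have "(\<Sum>h\<in>?Fs. ?B - ?w h) \<le> (\<Sum>g\<in>F N. ?B - ?w (g * s))"
    unfolding right_translate_def
    using sum_image_le[of "F N" "\<lambda>h. ?B - ?w h" "\<lambda>f. f * s"] finite_F[OF N] representation_bounded
    by (simp add: o_def)
  then have "(\<Sum>g\<in>F N. ?w (g * s)) \<le> sum ?w ?Fs + (real (card (F N)) - real (card ?Fs)) * ?B"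
    by (simp add: sum_subtractf left_diff_distrib)
  also have "(real (card (F N)) - real (card ?Fs)) * ?B \<le> real (card (D N s)) * ?B"
  proof (intro mult_right_mono B)
    \<comment> \<open>The collisions number \<open>card (F N) - card ?Fs\<close>, which is at most
      the number of points of \<open>F N\<close> outside the translate.\<close>
    have "card (F N) \<le> card (?Fs \<union> D N s)"
      using N by (intro card_mono) (auto simp: D_def finite_F finite_translate)
    also have "\<dots> \<le> card ?Fs + card (D N s)"
      by (rule card_Un_le)
    finally show "real (card (F N)) - real (card ?Fs) \<le> real (card (D N s))"
      by simp
  qed
  also have "sum ?w ?Fs \<le> sum ?w (F N \<union> D N s)"
    using N by (intro sum_mono2) (auto simp: D_def finite_F finite_translate)
  also have "\<dots> \<le> sum ?w (F N) + sum ?w (D N s)"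
    using N by (simp add: sum_Un finite_D finite_F sum_nonneg)
  also have "(\<Sum>g\<in>F N. ?w (g * s)) = (\<Sum>g\<in>F N. (norm (\<pi> g (\<pi> s x)))\<^sup>2)"
    by (simp add: rep_mult)
  finally have "(\<Sum>g\<in>F N. (norm (\<pi> g (\<pi> s x)))\<^sup>2) \<le> sum ?w (F N)
      + (norm x)\<^sup>2 * (\<Sum>g\<in>D N s. (norm (\<pi> g))\<^sup>2) + ?B * real (card (D N s))"
    using sum_D_le[where N = N and s = s and x = x] by (simp add: mult.commute)
  from divide_right_mono[OF this, of "real (card (F N))"] show ?thesis
    by (simp add: W_def add_divide_distrib)
qed

lemma W_asymptotically_invariant: "(\<lambda>N. W N (\<pi> s x) - W N x) \<longlonglongrightarrow> 0"
proof (rule Lim_null_comparison)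
  let ?d = "\<lambda>N. (norm x)\<^sup>2 * ((\<Sum>g\<in>D N s. (norm (\<pi> g))\<^sup>2) / real (card (F N)))"
  let ?e = "\<lambda>N. B * (norm x)\<^sup>2 * (real (card (D N s)) / real (card (F N)))"
  show "(\<lambda>N. ?d N + ?e N) \<longlonglongrightarrow> 0"
    using tendsto_add[OF tendsto_mult_left[OF norm_sym_diff[of s], of "(norm x)\<^sup>2"]
        tendsto_mult_left[OF card_sym_diff[of s], of "B * (norm x)\<^sup>2"]]
    by (simp add: D_def)
  have "norm (W N (\<pi> s x) - W N x) \<le> ?d N + ?e N" if "N \<ge> 1" for N
  proof -
    have "0 \<le> ?e N"
      by (simp add: B_def)
    then show ?thesis
      using W_le_W_translate[OF that, of x s] W_translate_le_W[OF that, of s x]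
      unfolding real_norm_def by linarith
  qed
  then show "\<forall>\<^sub>F N in sequentially. norm (W N (\<pi> s x) - W N x) \<le> ?d N + ?e N"
    using eventually_at_top_linorder by blast
qed

section \<open>The averaged forms and their invariant limit\<close>

definition form :: "nat \<Rightarrow> 'h \<Rightarrow> 'h \<Rightarrow> real"
  where "form N x y = (\<Sum>g\<in>F N. rinner (\<pi> g x) (\<pi> g y)) / real (card (F N))"

lemma form_self: "form N x x = W N x"
  by (simp add: form_def W_def rinner_self)

lemma form_commute: "form N x y = form N y x"
  by (simp add: form_def rinner_commute)

lemma form_scaleC: "form N x (c *\<^sub>C y) = form N (cnj c *\<^sub>C x) y"
  using rep_ops by (simp add: form_def bounded_ops_def rinner_scaleC)

lemma bilinear_form: "bilinear (form N)"
  unfolding bilinear_def form_def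
  by (intro conjI allI linearI)
    (simp_all add: blinfun.add_right blinfun.scaleR_right sum.distrib add_divide_distrib
      bilinear_ladd[OF bilinear_rinner] bilinear_radd[OF bilinear_rinner]
      bilinear_lmul[OF bilinear_rinner] bilinear_rmul[OF bilinear_rinner] flip: sum_distrib_left)

lemma form_bound:
  assumes "N \<ge> 1"
  shows "\<bar>form N x y\<bar> \<le> M\<^sup>2 * norm x * norm y"
proof (rule symmetric_form_bound[OF bilinear_form form_commute])
  show "\<bar>form N x x\<bar> \<le> M\<^sup>2 * (norm x)\<^sup>2" for x
    using average_le[OF assms, of x] by (simp add: form_self W_def sum_nonneg)
qed

text \<open>The algebraic identities and the bounds survive pointwise limits along \<open>G\<close>.
  Invariance is obtained on the diagonal, which is what norm preservation requires.\<close>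

lemma invariant_form:
  obtains q where "bilinear q" "\<And>x y. q x y = q y x"
    "\<And>c x y. q x (c *\<^sub>C y) = q (cnj c *\<^sub>C x) y"
    "\<And>x. m\<^sup>2 * (norm x)\<^sup>2 \<le> q x x" "\<And>x. q x x \<le> M\<^sup>2 * (norm x)\<^sup>2"
    "\<And>s x. q (\<pi> s x) (\<pi> s x) = q x x"
proof -
  \<comment> \<open>The bounds start at \<open>N = 1\<close> while the cluster point lemma asks for
    every index, hence \<open>Suc N\<close>; pairs serve as the points of evaluation.\<close>
  have "\<bar>case z of (x, y) \<Rightarrow> form (Suc N) x y\<bar> \<le> (case z of (x, y) \<Rightarrow> M\<^sup>2 * norm x * norm y)" for N z
    using form_bound[of "Suc N"] by (auto split: prod.split)
  then obtain G q' where G: "G \<noteq> bot" "G \<le> sequentially"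
    and q': "\<And>z. ((\<lambda>N. case z of (x, y) \<Rightarrow> form (Suc N) x y) \<longlongrightarrow> q' z) G"
    using pointwise_cluster_point[of "\<lambda>N z. case z of (x, y) \<Rightarrow> form (Suc N) x y"] by metis
  define q where "q x y = q' (x, y)" for x y
  have q: "((\<lambda>N. form (Suc N) x y) \<longlongrightarrow> q x y) G" for x y
    using q'[of "(x, y)"] by (simp add: q_def)
  have unique: "q x y = l" if "((\<lambda>N. form (Suc N) x y) \<longlongrightarrow> l) G" for x y l
    using tendsto_unique[OF G(1) q that] .
  show thesis
  proof
    show sym: "q x y = q y x" for x y
      by (rule unique) (subst form_commute, rule q)
    have add: "q x (y + z) = q x y + q x z" for x y z
      by (rule unique) (unfold bilinear_radd[OF bilinear_form], intro tendsto_add q)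
    have mul: "q x (r *\<^sub>R y) = r *\<^sub>R q x y" for x y r
      by (rule unique) (unfold bilinear_rmul[OF bilinear_form], intro tendsto_scaleR tendsto_const q)
    show "bilinear q"
      unfolding bilinear_def
      by (intro conjI allI linearI) (simp_all add: add mul sym[of _ x for x])
    show "q x (c *\<^sub>C y) = q (cnj c *\<^sub>C x) y" for c x y
      by (rule unique) (unfold form_scaleC, rule q)
    show "m\<^sup>2 * (norm x)\<^sup>2 \<le> q x x" for x
      using average_ge by (intro tendsto_lowerbound[OF q _ G(1)]) (simp add: form_self W_def)
    show "q x x \<le> M\<^sup>2 * (norm x)\<^sup>2" for x
      using average_le by (intro tendsto_upperbound[OF q _ G(1)]) (simp add: form_self W_def)
    show "q (\<pi> s x) (\<pi> s x) = q x x" for s x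
    proof -
      \<comment> \<open>\<open>G\<close> is finer than \<open>sequentially\<close>, so the ordinary
        limit \<open>0\<close> of the differences is also their limit along
        \<open>G\<close>.\<close>
      have "((\<lambda>N. form (Suc N) (\<pi> s x) (\<pi> s x) - form (Suc N) x x) \<longlongrightarrow> 0) G"
        using tendsto_mono[OF G(2) LIMSEQ_Suc[OF W_asymptotically_invariant[of s x]]]
        by (simp add: form_self)
      from tendsto_unique[OF G(1) tendsto_diff[OF q q] this] show ?thesis
        by simp
    qed
  qed
qed

end

text \<open>Moving the adjoint across the inner product turns each summand of the quadratic form
  into \<open>(norm (\<pi> g x))\<^sup>2\<close>.\<close>

lemma op_le_average_iff:
  fixes \<pi> :: "'s \<Rightarrow> ('h::complex_hilbert_space \<Rightarrow>\<^sub>L 'h)" and E :: "'s set"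
  assumes "\<And>g. \<pi> g \<in> bounded_ops"
  defines "A \<equiv> (1 / real (card E)) *\<^sub>R (\<Sum>g\<in>E. op_adjoint (\<pi> g) o\<^sub>L \<pi> g)"
  shows "op_le (r *\<^sub>R id_blinfun) A \<longleftrightarrow>
      (\<forall>x. r * (norm x)\<^sup>2 \<le> (\<Sum>g\<in>E. (norm (\<pi> g x))\<^sup>2) / real (card E))"
    and "op_le A (r *\<^sub>R id_blinfun) \<longleftrightarrow>
      (\<forall>x. (\<Sum>g\<in>E. (norm (\<pi> g x))\<^sup>2) / real (card E) \<le> r * (norm x)\<^sup>2)"
proof -
  have "rinner (op_adjoint (\<pi> g) (\<pi> g x)) x = (norm (\<pi> g x))\<^sup>2" for g x
    using rinner_op_adjoint[OF assms(1), of g x "\<pi> g x"] by (simp add: rinner_self rinner_commute)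
  then have "rinner (A x) x = (\<Sum>g\<in>E. (norm (\<pi> g x))\<^sup>2) / real (card E)" for x
    by (simp add: A_def blinfun.scaleR_left blinfun.sum_left rinner_scaleR_left
        bounded_bilinear.sum_left[OF bounded_bilinear_rinner])
  moreover have "rinner ((r *\<^sub>R id_blinfun :: 'h \<Rightarrow>\<^sub>L 'h) x) x = r * (norm x)\<^sup>2" for x
    by (simp add: blinfun.scaleR_left rinner_scaleR_left rinner_self)
  ultimately show "op_le (r *\<^sub>R id_blinfun) A \<longleftrightarrow>
      (\<forall>x. r * (norm x)\<^sup>2 \<le> (\<Sum>g\<in>E. (norm (\<pi> g x))\<^sup>2) / real (card E))"
    and "op_le A (r *\<^sub>R id_blinfun) \<longleftrightarrow>
      (\<forall>x. (\<Sum>g\<in>E. (norm (\<pi> g x))\<^sup>2) / real (card E) \<le> r * (norm x)\<^sup>2)"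
    by (simp_all add: op_le_def flip: rinner_def)
qed

theorem theorem3p2:
  fixes F :: "nat \<Rightarrow> 's::{semigroup_mult, countable} set"
    and \<pi> :: "'s \<Rightarrow> ('h::complex_hilbert_space \<Rightarrow>\<^sub>L 'h)"
    and m M :: real
  assumes "strong_Folner_condition TYPE('s)"
    and "right_Folner_sequence F"
    and "op_representation \<pi>"
    and "m > 0" and "M > 0"
    and "\<And>N. N \<ge> 1 \<Longrightarrow>
      op_le (m\<^sup>2 *\<^sub>R id_blinfun)
        ((1 / real (card (F N))) *\<^sub>R (\<Sum>g\<in>F N. op_adjoint (\<pi> g) o\<^sub>L \<pi> g))"
    and "\<And>N. N \<ge> 1 \<Longrightarrow>
      op_le ((1 / real (card (F N))) *\<^sub>R (\<Sum>g\<in>F N. op_adjoint (\<pi> g) o\<^sub>L \<pi> g))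
        (M\<^sup>2 *\<^sub>R id_blinfun)"
    and "\<And>s. (\<lambda>N. (1 / real (card (F N))) *
        (\<Sum>g\<in>sym_diff (right_translate (F N) s) (F N). (norm (\<pi> g))\<^sup>2)) \<longlonglongrightarrow> 0"
  shows "\<exists>L\<in>bounded_ops. \<exists>L'\<in>bounded_ops.
    L o\<^sub>L L' = id_blinfun \<and> L' o\<^sub>L L = id_blinfun \<and>
    norm L' * norm L \<le> M / m \<and>
    isometric_representation (\<lambda>s. L' o\<^sub>L \<pi> s o\<^sub>L L)"
proof -
  have rep_ops: "\<pi> s \<in> bounded_ops" for s
    using assms(3) by (simp add: op_representation_def)
  interpret Folner_bounded_representation F \<pi> m M
  proof
    show "finite (F N)" "F N \<noteq> {}" if "N \<ge> 1" for N
      using assms(2) that by (auto simp: right_Folner_sequence_def)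
    show "(\<lambda>N. real (card (sym_diff (right_translate (F N) s) (F N))) / real (card (F N))) \<longlonglongrightarrow> 0" for s
      using assms(2) by (simp add: right_Folner_sequence_def)
    show "\<pi> (s * t) x = \<pi> s (\<pi> t x)" for s t x
      using assms(3) by (simp add: op_representation_def)
    show "m\<^sup>2 * (norm x)\<^sup>2 \<le> (\<Sum>g\<in>F N. (norm (\<pi> g x))\<^sup>2) / real (card (F N))" if "N \<ge> 1" for N x
      using assms(6)[OF that] by (simp add: op_le_average_iff rep_ops)
    show "(\<Sum>g\<in>F N. (norm (\<pi> g x))\<^sup>2) / real (card (F N)) \<le> M\<^sup>2 * (norm x)\<^sup>2" if "N \<ge> 1" for N x
      using assms(7)[OF that] by (simp add: op_le_average_iff rep_ops)
    show "(\<lambda>N. (\<Sum>g\<in>sym_diff (right_translate (F N) s) (F N). (norm (\<pi> g))\<^sup>2) / real (card (F N)))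
        \<longlonglongrightarrow> 0" for s
      using assms(8)[of s] by simp
  qed (use assms rep_ops in auto)
  obtain q where q: "bilinear q" "\<And>x y. q x y = q y x"
    "\<And>c x y. q x (c *\<^sub>C y) = q (cnj c *\<^sub>C x) y"
    "\<And>x. m\<^sup>2 * (norm x)\<^sup>2 \<le> q x x" "\<And>x. q x x \<le> M\<^sup>2 * (norm x)\<^sup>2"
    and inv: "\<And>s x. q (\<pi> s x) (\<pi> s x) = q x x"
    using invariant_form by blast
  obtain L L' :: "'h \<Rightarrow>\<^sub>L 'h" where L: "L \<in> bounded_ops" "L' \<in> bounded_ops"
    "L o\<^sub>L L' = id_blinfun" "L' o\<^sub>L L = id_blinfun" "norm L' * norm L \<le> M / m"
    and norm_L': "\<And>x. q x x = M\<^sup>2 * (norm (blinfun_apply L' x))\<^sup>2"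
    using similarity_of_form[OF q(1-3) m M q(4,5)] by metis
  have L_L': "L (L' x) = x" "L' (L x) = x" for x
    using L(3,4) by (metis blinfun_apply_blinfun_compose id_blinfun.rep_eq)+
  have V_ops: "L' o\<^sub>L \<pi> s o\<^sub>L L \<in> bounded_ops" for s
    using L(1,2) rep_ops by (simp add: bounded_ops_def)
  have "norm ((L' o\<^sub>L \<pi> s o\<^sub>L L) x) = norm x" for s x
  proof -
    \<comment> \<open>Invariance of \<open>q\<close> at \<open>L x\<close>, read through
      \<open>norm_L'\<close>; the factor \<open>M\<^sup>2\<close> cancels.\<close>
    have "(norm (L' (\<pi> s (L x))))\<^sup>2 = (norm (L' (L x)))\<^sup>2"
      using inv[of s "L x"] M by (simp add: norm_L')
    then show ?thesis
      by (simp add: L_L')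
  qed
  then have "op_adjoint (L' o\<^sub>L \<pi> s o\<^sub>L L) o\<^sub>L (L' o\<^sub>L \<pi> s o\<^sub>L L) = id_blinfun" for s
    by (rule op_adjoint_compose_eq_id[OF V_ops])
  moreover have "L' o\<^sub>L \<pi> (s * t) o\<^sub>L L = (L' o\<^sub>L \<pi> s o\<^sub>L L) o\<^sub>L (L' o\<^sub>L \<pi> t o\<^sub>L L)" for s t
    by (rule blinfun_eqI) (simp add: rep_mult L_L')
  ultimately have "isometric_representation (\<lambda>s. L' o\<^sub>L \<pi> s o\<^sub>L L)"
    unfolding isometric_representation_def op_representation_def using V_ops by blast
  then show ?thesis
    using L by blast
qed

end
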